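(* Let $\xi>0$, $\alpha>0$ be arbitrary. Assume that $V_x:\mathbb{R}_{\ge 0}\to\mathbb{R}_{\ge 0}$ and $V_u:\mathbb{R}_{\ge 0}\to\mathbb{R}_{\ge 0}$ are differentiable nonnegative functions satisfying, for almost all $t\ge 0$, $$\dot V_x(t)\le -\mu_1 V_x(t)+\theta_1 V_u(t),\qquad \dot V_u(t)\le \alpha\left(\theta_2 V_x(t)-\mu_2 V_u(t)\right),$$ for some $\mu_1,\mu_2,\theta_1,\theta_2>0$ such that $$-\mu_1+\xi\theta_1<0,\qquad \theta_2-\xi\mu_2<0.$$ Then $V:=\max\{\xi V_x,V_u\}$ satisfies $V(t)\le e^{-\tau t}V(0)$ for all $t\ge 0$, where $\tau=\min\{\mu_1-\xi\theta_1,\ \alpha(\mu_2-\frac{\theta_2}{\xi})\}>0$.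
   Context: $\mathbb{R}_{\ge 0}=[0,\infty)$ and $\mathbb{R}_{>0}=(0,\infty)$. A function $V:\mathbb{R}_{\ge 0}\to\mathbb{R}$ is said to be differentiable if it is differentiable on the open set $\mathbb{R}_{>0}$; $\dot V(t)$ denotes its derivative at $t$.
   Formalization: V_x and V_u are additionally assumed continuous at t=0; differentiability on the open half-line alone allows a jump at 0 (e.g. V_x=V_u=e^{-t} for t>0, value 0 at t=0, ξ=α=θ_i=1, μ_i=2), for which the claimed bound fails. *)

theory Defs
  imports "HOL-Analysis.Analysis"
begin

end

theory Submission
  imports Defs
begin

text \<open>
  Multiply both functions by the expected growth factor: with
  \<open>f t = \<xi> * exp (\<tau> * t) * V\<^sub>x t\<close> and \<open>g t = exp (\<tau> * t) * V\<^sub>u t\<close> the claim is that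
  \<open>max f g\<close> never exceeds its initial value. At a time outside the exceptional null set \<open>N\<close>, the
  larger of the two functions has derivative at most zero: where \<open>V\<^sub>u \<le> \<xi> * V\<^sub>x\<close>, the first
  inequality gives \<open>V\<^sub>x' \<le> - (\<mu>\<^sub>1 - \<xi> * \<theta>\<^sub>1) * V\<^sub>x \<le> - \<tau> * V\<^sub>x\<close>, and where
  \<open>\<xi> * V\<^sub>x \<le> V\<^sub>u\<close> the second one gives \<open>V\<^sub>u' \<le> - \<alpha> * (\<mu>\<^sub>2 - \<theta>\<^sub>2 / \<xi>) * V\<^sub>u \<le> - \<tau> * V\<^sub>u\<close>.
  The last step of each chain uses that \<open>V\<^sub>x\<close> and \<open>V\<^sub>u\<close> are nonnegative.

  The difficulty is the null set \<open>N\<close>: the functions are differentiable at every positive time but not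
  assumed absolutely continuous, so the derivative inequality cannot simply be integrated. Instead, a
  differentiable function maps a null set to a null set. If a continuous function \<open>h\<close> had
  \<open>h a < h b\<close>, every level strictly in between would be attained at a last time in \<open>[a, b]\<close>, after
  which \<open>h\<close> stays above that level. For \<open>h = max f g\<close>, tilted downwards by a small linear term, such
  last times can only lie in \<open>N\<close>, so the whole interval of levels would lie in the null set
  \<open>f ` N \<union> g ` N\<close> (for the tilted \<open>f\<close> and \<open>g\<close>), which is impossible. Lemma \<open>le_if_not_increasing_off_null_image\<close> is the
  level argument, and \<open>max_le_initial_if_deriv_nonpos_AE\<close> applies it to a maximum.
\<close>

text \<open>
  The hypothesis says that no point outside \<open>N\<close> can be the last time at which \<open>h\<close> passes a level
  below \<open>h b\<close>; and the levels passed inside \<open>N\<close> are too few to fill an interval.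
\<close>

lemma le_if_not_increasing_off_null_image:
  fixes h :: "real \<Rightarrow> real"
  assumes "a \<le> b" and cont: "continuous_on {a..b} h" and null: "negligible (h ` N)"
    and return: "\<And>t. a < t \<Longrightarrow> t < b \<Longrightarrow> t \<notin> N \<Longrightarrow> \<exists>x. t < x \<and> x \<le> b \<and> h x \<le> h t"
  shows "h b \<le> h a"
proof (rule ccontr)
  assume "\<not> h b \<le> h a"
  then have less: "h a < h b" by simp
  have "{h a<..<h b} \<subseteq> h ` N"
  proof
    fix y assume y: "y \<in> {h a<..<h b}"
    define S where "S = {x \<in> {a..b}. h x \<le> y}"
    have "compact S"
    proof -
      have "closed S"
        unfolding S_def using cont by (intro continuous_on_closed_Collect_le) auto
      moreover have "bounded S"
        by (rule bounded_subset[of "{a..b}"]) (auto simp: S_def)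
      ultimately show ?thesis
        by (simp add: compact_eq_bounded_closed)
    qed
    moreover have "a \<in> S"
      using y \<open>a \<le> b\<close> by (auto simp: S_def)
    ultimately obtain c where c: "c \<in> S" and last: "\<And>x. x \<in> S \<Longrightarrow> x \<le> c"
      using compact_attains_sup[of S] by blast
    have above: "y < h x" if "c < x" "x \<le> b" for x
      using last[of x] that c by (force simp: S_def)
    have "c < b"
      using c y by (cases "c = b") (auto simp: S_def)
    have "h c = y"
    proof (rule ccontr)
      assume "h c \<noteq> y"
      then have "h c < y" using c by (simp add: S_def)
      then obtain x where "c \<le> x" "x \<le> b" "h x = y"
        using IVT'[of h c y b] y \<open>c < b\<close> c continuous_on_subset[OF cont, of "{c..b}"]
        by (auto simp: S_def)
      then show False
        using above[of x] \<open>h c < y\<close> by (cases "x = c") auto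
    qed
    moreover have "a < c"
      using c y \<open>h c = y\<close> by (cases "c = a") (auto simp: S_def)
    ultimately have "c \<in> N"
      using return[of c] above \<open>c < b\<close> by force
    then show "y \<in> h ` N"
      using \<open>h c = y\<close> by blast
  qed
  then have "negligible {h a<..<h b}"
    using null negligible_subset by blast
  then show False
    using open_not_negligible[of "{h a<..<h b}"] less by simp
qed

lemma eventually_at_right_less_max:
  fixes f g :: "real \<Rightarrow> real"
  assumes deriv: "(f has_real_derivative D) (at t)" and neg: "g t \<le> f t \<Longrightarrow> D < 0"
  shows "\<forall>\<^sub>F x in at_right t. f x < max (f t) (g t)"
proof (cases "g t \<le> f t")
  case True
  then obtain d where "0 < d" and dec: "\<And>h. 0 < h \<Longrightarrow> h < d \<Longrightarrow> f (t + h) < f t"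
    using DERIV_neg_dec_right[OF deriv] neg by blast
  have "f x < f t" if "t < x" "x < t + d" for x
    using dec[of "x - t"] that by simp
  then have "\<forall>\<^sub>F x in at_right t. f x < f t"
    using \<open>0 < d\<close> by (auto simp: eventually_at_right_field intro!: exI[of _ "t + d"])
  then show ?thesis
    by (rule eventually_mono) simp
next
  case False
  have "(f \<longlongrightarrow> f t) (at_right t)"
    using DERIV_isCont[OF deriv] by (simp add: isCont_def filterlim_at_split)
  then show ?thesis
    using False by (intro order_tendstoD(2)) auto
qed

text \<open>
  Where \<open>f\<close> and \<open>g\<close> agree, their maximum need not be differentiable. Only its behaviour to the
  right matters, and there it decreases once both derivatives are negative. Subtracting
  \<open>\<epsilon> * (t - a)\<close> from both functions makes the nonpositive derivatives negative without
  affecting which function is the larger one.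
\<close>

lemma max_le_initial_if_deriv_nonpos_AE:
  fixes f g f' g' :: "real \<Rightarrow> real"
  assumes "a \<le> b"
    and contf: "continuous_on {a..b} f" and contg: "continuous_on {a..b} g"
    and derf: "\<And>t. a < t \<Longrightarrow> t < b \<Longrightarrow> (f has_real_derivative f' t) (at t)"
    and derg: "\<And>t. a < t \<Longrightarrow> t < b \<Longrightarrow> (g has_real_derivative g' t) (at t)"
    and null: "negligible N"
    and f'_le: "\<And>t. a < t \<Longrightarrow> t < b \<Longrightarrow> t \<notin> N \<Longrightarrow> g t \<le> f t \<Longrightarrow> f' t \<le> 0"
    and g'_le: "\<And>t. a < t \<Longrightarrow> t < b \<Longrightarrow> t \<notin> N \<Longrightarrow> f t \<le> g t \<Longrightarrow> g' t \<le> 0"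
  shows "max (f b) (g b) \<le> max (f a) (g a)"
proof (rule field_le_epsilon)
  fix e :: real assume "0 < e"
  \<comment> \<open>The summand 1 keeps the denominator positive when \<open>a = b\<close>.\<close>
  define \<epsilon> where "\<epsilon> = e / (b - a + 1)"
  have \<epsilon>: "0 < \<epsilon>" "\<epsilon> * (b - a) \<le> e"
    using \<open>0 < e\<close> \<open>a \<le> b\<close> by (auto simp: \<epsilon>_def field_simps)
  define F where "F t = f t - \<epsilon> * (t - a)" for t
  define G where "G t = g t - \<epsilon> * (t - a)" for t
  define M where "M = N \<inter> {a<..<b}"
  have derF: "(F has_real_derivative f' t - \<epsilon>) (at t)" if "a < t" "t < b" for t
    unfolding F_def using derf[OF that] by (auto intro!: derivative_eq_intros)
  have derG: "(G has_real_derivative g' t - \<epsilon>) (at t)" if "a < t" "t < b" for t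
    unfolding G_def using derg[OF that] by (auto intro!: derivative_eq_intros)
  have "negligible M"
    using null by (auto simp: M_def intro: negligible_subset)
  moreover have "F differentiable_on M" "G differentiable_on M"
    using derF derG unfolding M_def
    by (auto simp: differentiable_on_def real_differentiable_def)
       (meson has_field_derivative_at_within)+
  ultimately have "negligible (F ` M \<union> G ` M)"
    by (simp add: negligible_differentiable_image_negligible)
  then have "negligible ((\<lambda>t. max (F t) (G t)) ` M)"
    by (rule negligible_subset) (auto simp: max_def)
  moreover have "continuous_on {a..b} (\<lambda>t. max (F t) (G t))"
    unfolding F_def G_def by (intro continuous_intros contf contg)
  moreover have "\<exists>x. t < x \<and> x \<le> b \<and> max (F x) (G x) \<le> max (F t) (G t)"
    if t: "a < t" "t < b" "t \<notin> M" for t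
  proof -
    have "t \<notin> N" using t by (simp add: M_def)
    have "\<forall>\<^sub>F x in at_right t. F x < max (F t) (G t)"
    proof (rule eventually_at_right_less_max[OF derF])
      show "f' t - \<epsilon> < 0" if "G t \<le> F t"
        using f'_le[of t] t \<open>t \<notin> N\<close> \<epsilon> that by (simp add: F_def G_def)
    qed (use t in auto)
    moreover have "\<forall>\<^sub>F x in at_right t. G x < max (G t) (F t)"
    proof (rule eventually_at_right_less_max[OF derG])
      show "g' t - \<epsilon> < 0" if "F t \<le> G t"
        using g'_le[of t] t \<open>t \<notin> N\<close> \<epsilon> that by (simp add: F_def G_def)
    qed (use t in auto)
    moreover have "\<forall>\<^sub>F x in at_right t. t < x \<and> x < b"
      using t eventually_at_right_field by blast
    ultimately have "\<forall>\<^sub>F x in at_right t. t < x \<and> x \<le> b \<and> max (F x) (G x) \<le> max (F t) (G t)"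
      by eventually_elim (auto simp: max_def split: if_splits)
    then show ?thesis
      using eventually_happens trivial_limit_at_right_real by blast
  qed
  ultimately have "max (F b) (G b) \<le> max (F a) (G a)"
    by (intro le_if_not_increasing_off_null_image[OF \<open>a \<le> b\<close>])
  then show "max (f b) (g b) \<le> max (f a) (g a) + e"
    using \<epsilon> by (auto simp: F_def G_def max_def split: if_splits)
qed

theorem lemma3:
  fixes V\<^sub>x V\<^sub>u :: "real \<Rightarrow> real"
    and \<xi> \<alpha> \<mu>\<^sub>1 \<mu>\<^sub>2 \<theta>\<^sub>1 \<theta>\<^sub>2 :: real
  assumes "\<xi> > 0" and "\<alpha> > 0"
    and "\<And>t. t \<ge> 0 \<Longrightarrow> V\<^sub>x t \<ge> 0" and "\<And>t. t \<ge> 0 \<Longrightarrow> V\<^sub>u t \<ge> 0"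
    and "continuous_on {0..} V\<^sub>x" and "continuous_on {0..} V\<^sub>u"
    and "V\<^sub>x differentiable_on {0<..}" and "V\<^sub>u differentiable_on {0<..}"
    and "\<mu>\<^sub>1 > 0" and "\<mu>\<^sub>2 > 0" and "\<theta>\<^sub>1 > 0" and "\<theta>\<^sub>2 > 0"
    and "AE t in lebesgue. t \<ge> 0 \<longrightarrow>
           deriv V\<^sub>x t \<le> - \<mu>\<^sub>1 * V\<^sub>x t + \<theta>\<^sub>1 * V\<^sub>u t \<and>
           deriv V\<^sub>u t \<le> \<alpha> * (\<theta>\<^sub>2 * V\<^sub>x t - \<mu>\<^sub>2 * V\<^sub>u t)"
    and "- \<mu>\<^sub>1 + \<xi> * \<theta>\<^sub>1 < 0" and "\<theta>\<^sub>2 - \<xi> * \<mu>\<^sub>2 < 0"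
  shows "let V = (\<lambda>t. max (\<xi> * V\<^sub>x t) (V\<^sub>u t));
             \<tau> = min (\<mu>\<^sub>1 - \<xi> * \<theta>\<^sub>1) (\<alpha> * (\<mu>\<^sub>2 - \<theta>\<^sub>2 / \<xi>))
         in \<tau> > 0 \<and> (\<forall>t\<ge>0. V t \<le> exp (- \<tau> * t) * V 0)"
proof -
  define \<tau> where "\<tau> = min (\<mu>\<^sub>1 - \<xi> * \<theta>\<^sub>1) (\<alpha> * (\<mu>\<^sub>2 - \<theta>\<^sub>2 / \<xi>))"
  have \<tau>_le: "\<tau> \<le> \<mu>\<^sub>1 - \<xi> * \<theta>\<^sub>1" "\<tau> \<le> \<alpha> * (\<mu>\<^sub>2 - \<theta>\<^sub>2 / \<xi>)"
    by (simp_all add: \<tau>_def)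
  have "0 < \<alpha> * (\<mu>\<^sub>2 - \<theta>\<^sub>2 / \<xi>)"
    using assms(1,2,15) by (intro mult_pos_pos) (auto simp: field_simps)
  then have "0 < \<tau>"
    using assms(14) by (simp add: \<tau>_def)
  obtain N where N: "negligible N"
    and rates: "\<And>t. 0 < t \<Longrightarrow> t \<notin> N \<Longrightarrow>
      deriv V\<^sub>x t \<le> - \<mu>\<^sub>1 * V\<^sub>x t + \<theta>\<^sub>1 * V\<^sub>u t \<and>
      deriv V\<^sub>u t \<le> \<alpha> * (\<theta>\<^sub>2 * V\<^sub>x t - \<mu>\<^sub>2 * V\<^sub>u t)"
    using assms(13) by (elim AE_E3) (auto simp: negligible_iff_null_sets)
  have derx: "(V\<^sub>x has_real_derivative deriv V\<^sub>x t) (at t)" if "0 < t" for t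
    using assms(7) that
    by (simp add: differentiable_on_eq_differentiable_at DERIV_deriv_iff_real_differentiable)
  have deru: "(V\<^sub>u has_real_derivative deriv V\<^sub>u t) (at t)" if "0 < t" for t
    using assms(8) that
    by (simp add: differentiable_on_eq_differentiable_at DERIV_deriv_iff_real_differentiable)
  have decay_x: "\<tau> * V\<^sub>x t + deriv V\<^sub>x t \<le> 0" if "0 < t" "t \<notin> N" "V\<^sub>u t \<le> \<xi> * V\<^sub>x t" for t
  proof -
    have "\<theta>\<^sub>1 * V\<^sub>u t \<le> \<theta>\<^sub>1 * (\<xi> * V\<^sub>x t)"
      using that assms(11) by (intro mult_left_mono) auto
    moreover have "\<tau> * V\<^sub>x t \<le> (\<mu>\<^sub>1 - \<xi> * \<theta>\<^sub>1) * V\<^sub>x t"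
      using that assms(3) \<tau>_le by (intro mult_right_mono) auto
    ultimately show ?thesis
      using rates[OF that(1,2)] by (simp add: algebra_simps)
  qed
  have decay_u: "\<tau> * V\<^sub>u t + deriv V\<^sub>u t \<le> 0" if "0 < t" "t \<notin> N" "\<xi> * V\<^sub>x t \<le> V\<^sub>u t" for t
  proof -
    have "V\<^sub>x t \<le> V\<^sub>u t / \<xi>"
      using that assms(1) by (simp add: field_simps)
    then have "\<alpha> * \<theta>\<^sub>2 * V\<^sub>x t \<le> \<alpha> * \<theta>\<^sub>2 * (V\<^sub>u t / \<xi>)"
      using assms(2,12) by (intro mult_left_mono) auto
    moreover have "\<tau> * V\<^sub>u t \<le> \<alpha> * (\<mu>\<^sub>2 - \<theta>\<^sub>2 / \<xi>) * V\<^sub>u t"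
      using that assms(4) \<tau>_le by (intro mult_right_mono) auto
    ultimately show ?thesis
      using rates[OF that(1,2)] by (simp add: algebra_simps)
  qed
  have bound: "max (\<xi> * V\<^sub>x t) (V\<^sub>u t) \<le> exp (- \<tau> * t) * max (\<xi> * V\<^sub>x 0) (V\<^sub>u 0)"
    if "0 \<le> t" for t
  proof -
    define f where "f s = exp (\<tau> * s) * (\<xi> * V\<^sub>x s)" for s
    define g where "g s = exp (\<tau> * s) * V\<^sub>u s" for s
    define f' where "f' s = exp (\<tau> * s) * (\<xi> * (\<tau> * V\<^sub>x s + deriv V\<^sub>x s))" for s
    define g' where "g' s = exp (\<tau> * s) * (\<tau> * V\<^sub>u s + deriv V\<^sub>u s)" for s
    have "max (f t) (g t) \<le> max (f 0) (g 0)"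
    proof (rule max_le_initial_if_deriv_nonpos_AE[where N = N and f' = f' and g' = g'])
      show "continuous_on {0..t} f"
        unfolding f_def by (intro continuous_intros continuous_on_subset[OF assms(5)]) auto
      show "continuous_on {0..t} g"
        unfolding g_def by (intro continuous_intros continuous_on_subset[OF assms(6)]) auto
      show "(f has_real_derivative f' s) (at s)" if "0 < s" for s
        unfolding f_def f'_def using derx[OF that]
        by (auto intro!: derivative_eq_intros simp: algebra_simps)
      show "(g has_real_derivative g' s) (at s)" if "0 < s" for s
        unfolding g_def g'_def using deru[OF that]
        by (auto intro!: derivative_eq_intros simp: algebra_simps)
      show "f' s \<le> 0" if "0 < s" "s \<notin> N" "g s \<le> f s" for s
        using decay_x[of s] that assms(1)
        by (simp add: f_def g_def f'_def mult_le_0_iff)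
      show "g' s \<le> 0" if "0 < s" "s \<notin> N" "f s \<le> g s" for s
        using decay_u[of s] that by (simp add: f_def g_def g'_def mult_le_0_iff)
    qed (use that N in auto)
    then have "exp (\<tau> * t) * max (\<xi> * V\<^sub>x t) (V\<^sub>u t) \<le> max (\<xi> * V\<^sub>x 0) (V\<^sub>u 0)"
      by (simp add: f_def g_def max_mult_distrib_left)
    then show ?thesis
      by (simp add: exp_minus field_simps del: max.bounded_iff)
  qed
  show ?thesis
    using \<open>0 < \<tau>\<close> bound unfolding Let_def \<tau>_def[symmetric] by blast
qed

end
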